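(* Let $X$ be an infinite-dimensional complex Banach space and let $T\in\mathcal{B}(X)$. The following statements are equivalent: (i) $T$ is essentially left Drazin invertible. (ii) $a_e(T)<\infty$ and $\mathcal{N}(T^n)$ and $\mathcal{R}(T^n)$ are topologically complemented for every $n\ge a_e(T)$.
   Context: $\mathcal{B}(X)$ is the algebra of bounded linear operators on $X$; $\mathcal{N}(T)$, $\mathcal{R}(T)$ denote kernel and range; $\mathbb{N}_0=\{0,1,2,\dots\}$, $\mathbb{N}=\{1,2,\dots\}$; the infimum of the empty set is $\infty$. A subspace of $X$ is topologically complemented if it is closed and has a closed algebraic complement in $X$. The essential ascent $a_e(T)$ is the smallest $n\in\mathbb{N}_0$ with $\dim(\mathcal{N}(T)\cap\mathcal{R}(T^n))<\infty$ ($\infty$ if there is none). The degree of stable iteration is $\operatorname{dis}(T)=\inf\{n\in\mathbb{N}_0: m\ge n,\ m\in\mathbb{N}\Rightarrow \mathcal{N}(T)\cap\mathcal{R}(T^n)=\mathcal{N}(T)\cap\mathcal{R}(T^m)\}$. $T$ is essentially left Drazin invertible if $a_e(T)<\infty$ and $\mathcal{R}(T)+\mathcal{N}(T^{\operatorname{dis}(T)})$ is topologically complemented in $X$. *)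

theory Defs
  imports "HOL-Analysis.Analysis"
begin

text \<open>
  HOL-Analysis provides only real vector spaces as type classes. A complex one is a real one
  with a complex scalar multiplication extending the real one.
\<close>

class complex_vector = real_vector +
  fixes scaleC :: "complex \<Rightarrow> 'a \<Rightarrow> 'a"  (infixr \<open>*\<^sub>C\<close> 75)
  assumes scaleC_of_real: "scaleC (complex_of_real r) x = scaleR r x"
    and scaleC_add_right: "scaleC a (x + y) = scaleC a x + scaleC a y"
    and scaleC_add_left: "scaleC (a + b) x = scaleC a x + scaleC b x"
    and scaleC_scaleC: "scaleC a (scaleC b x) = scaleC (a * b) x"
    and scaleC_one: "scaleC 1 x = x"

class complex_normed_vector = complex_vector + real_normed_vector +
  assumes norm_scaleC: "norm (scaleC a x) = cmod a * norm x"

class complex_banach = complex_normed_vector + banach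

global_interpretation complex_vector:
  vector_space "scaleC :: complex \<Rightarrow> 'a::complex_vector \<Rightarrow> 'a"
  defines csubspace = complex_vector.subspace
    and cspan = complex_vector.span
  by unfold_locales
    (simp_all add: scaleC_add_right scaleC_add_left scaleC_scaleC scaleC_one)

text \<open>Applied to subspaces only; for these it is the usual notion.\<close>

definition cfinite_dim :: "'a::complex_vector set \<Rightarrow> bool" where
  "cfinite_dim V \<longleftrightarrow> (\<exists>B. finite B \<and> cspan B = V)"

definition bounded_clinear ::
    "('a::complex_normed_vector \<Rightarrow> 'b::complex_normed_vector) \<Rightarrow> bool" where
  "bounded_clinear f \<longleftrightarrow> bounded_linear f \<and> (\<forall>c x. f (c *\<^sub>C x) = c *\<^sub>C f x)"

definition null_space :: "('a \<Rightarrow> 'b::zero) \<Rightarrow> 'a set" where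
  "null_space f = {x. f x = 0}"

definition topologically_complemented :: "'a::complex_normed_vector set \<Rightarrow> bool" where
  "topologically_complemented M \<longleftrightarrow>
     csubspace M \<and> closed M \<and>
     (\<exists>N. csubspace N \<and> closed N \<and> M \<inter> N = {0} \<and> {x + y | x y. x \<in> M \<and> y \<in> N} = UNIV)"

text \<open>Infima are taken in \<^typ>\<open>enat\<close>, where the infimum of the empty set is \<open>\<infinity>\<close>.\<close>

definition essential_ascent :: "('a::complex_vector \<Rightarrow> 'a) \<Rightarrow> enat" where
  "essential_ascent T = Inf {enat n | n. cfinite_dim (null_space T \<inter> range (T ^^ n))}"

definition stable_iteration_degree :: "('a::complex_vector \<Rightarrow> 'a) \<Rightarrow> enat" where
  "stable_iteration_degree T =
     Inf {enat n | n. \<forall>m\<ge>n. m \<ge> 1 \<longrightarrow>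
            null_space T \<inter> range (T ^^ n) = null_space T \<inter> range (T ^^ m)}"

text \<open>
  If the essential ascent of a linear \<open>T\<close> is finite, so is its degree of stable iteration: from
  that point on the spaces \<open>null_space T \<inter> range (T ^^ n)\<close> form a decreasing sequence of
  finite-dimensional spaces. Hence \<^const>\<open>the_enat\<close> is only relevant on finite values here.
\<close>

definition essentially_left_Drazin_invertible ::
    "('a::complex_normed_vector \<Rightarrow> 'a) \<Rightarrow> bool" where
  "essentially_left_Drazin_invertible T \<longleftrightarrow>
     essential_ascent T < \<infinity> \<and>
     topologically_complemented
       {x + y | x y. x \<in> range T \<and> y \<in> null_space (T ^^ the_enat (stable_iteration_degree T))}"

end

theory Submission
  imports Defs
begin

text \<open>
  Write \<open>N\<^sub>k\<close>, \<open>R\<^sub>k\<close> for the kernel and the range of \<open>T ^^ k\<close>, and let \<open>d\<close> be the degree of stable iteration.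
  Finite essential ascent \<open>a\<close> means that \<open>N\<^sub>1 \<inter> R\<^sub>n\<close> is finite-dimensional for all \<open>n \<ge> a\<close>; a decreasing
  sequence of finite-dimensional spaces stabilizes, so \<open>d\<close> is then finite and \<open>a \<le> d\<close>. For \<open>n \<ge> a\<close> all \<open>N\<^sub>k \<inter> R\<^sub>n\<close> are finite-dimensional, and because \<open>T ^^ n\<close> maps \<open>N\<^sub>m\<close> into
  \<open>N\<^sub>m \<inter> R\<^sub>n\<close>, every \<open>N\<^sub>m\<close> lies in \<open>N\<^sub>n + G\<close> for some finite-dimensional \<open>G\<close>: all kernels of
  index at least \<open>a\<close> agree up to finite dimensions.

  The analytic tool is a criterion for two ranges of bounded operators on Banach spaces, such as sums
  \<open>f ` A + B\<close> with \<open>A\<close>, \<open>B\<close> closed: if they intersect in a finite-dimensional space and span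
  everything up to a finite-dimensional space, then they are complemented, hence closed
  (\<open>topologically_complemented_if_finite_overlap\<close>). It combines the open mapping theorem, which makes the
  projection onto one of two algebraically complementary operator ranges continuous, with the
  Hahn-Banach theorem, which complements the finite-dimensional intersection. With this criterion it is
  enough to count dimensions modulo finite-dimensional spaces.

  From \<open>R\<^sub>1 + N\<^sub>d\<close> being complemented one gets by induction that every \<open>R\<^sub>k + N\<^sub>d\<close> is complemented: this is
  the fact that the powers of the operator induced by \<open>T\<close> on \<open>X / N\<^sub>d\<close>, which has a finite-dimensional kernel
  and a complemented range, are of the same kind, written without quotients. If \<open>Z\<close> is a complement of
  \<open>R\<^sub>n + N\<^sub>d\<close>, then \<open>N\<^sub>d + Z\<close> is, up to finite dimensions, a complement of \<open>R\<^sub>n\<close>, and \<open>R\<^sub>n + Z\<close> one of \<open>N\<^sub>n\<close>.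

  Conversely, \<open>R\<^sub>1 + N\<^sub>d\<close> is the preimage of \<open>R\<^bsub>d+1\<^esub>\<close> under \<open>T ^^ d\<close>. If \<open>E\<close> and \<open>C\<close> are complements of
  \<open>N\<^sub>d\<close> and \<open>R\<^bsub>d+1\<^esub>\<close>, then the vectors of \<open>E\<close> that \<open>T ^^ d\<close> maps into \<open>C\<close> form a complement of it.
\<close>

section \<open>The open mapping theorem\<close>

text \<open>
  The Baire half of the open mapping theorem: the closures of the images of the balls of \<open>S\<close> cover the
  space, so one of them contains a ball. Restricting \<open>f\<close> to a subspace makes the result applicable to
  products of subspaces, whose images are sums.
\<close>

lemma bounded_linear_surj_imp_approx:
  fixes f :: "'b::banach \<Rightarrow> 'a::banach"
  assumes f: "bounded_linear f" and S: "subspace S" and surj: "f ` S = UNIV"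
  obtains K where "K > 0" "\<And>x. \<exists>s\<in>S. norm s \<le> K * norm x \<and> norm (x - f s) \<le> norm x / 2"
proof -
  interpret f: bounded_linear f by fact
  define A where "A n = closure (f ` (S \<inter> cball 0 (real n)))" for n
  have UN: "(\<Union>n. A n) = UNIV"
  proof -
    have "x \<in> (\<Union>n. A n)" for x
    proof -
      obtain s where s: "s \<in> S" "x = f s" using surj by (metis UNIV_I imageE)
      obtain n where "norm s \<le> real n" using real_arch_simple by blast
      then have "x \<in> A n" unfolding A_def using s closure_subset by fastforce
      then show ?thesis by blast
    qed
    then show ?thesis by blast
  qed
  have "\<exists>n. interior (A n) \<noteq> {}"
  proof (rule ccontr)
    assume "\<not> ?thesis"
    have "completely_metrizable_space (euclidean :: 'a topology)"
      using Met_TC.completely_metrizable_space_mtopology[where 'a='a]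
      by (simp add: mtopology_is_euclidean complete_UNIV)
    with \<open>\<not> ?thesis\<close> have "euclidean interior_of \<Union> (range A) = {}"
      by (intro Baire_category_alt)
        (auto simp: A_def simp flip: closed_closedin)
    then show False by (simp add: UN)
  qed
  then obtain n y r where r: "r > 0" "ball y r \<subseteq> A n"
    by (metis equals0I mem_interior)
  \<comment> \<open>Differences move the ball from \<open>y\<close> to the origin, which doubles the bound on the preimages.\<close>
  have small: "\<exists>s\<in>S. norm s \<le> 2 * real n \<and> norm (z - f s) < e" if z: "norm z < r" and e: "e > 0" for z e
  proof -
    have "y + z \<in> A n" "y \<in> A n"
      using r z by (auto intro!: subsetD[OF r(2)] simp: dist_norm)
    then have "\<exists>s\<in>S \<inter> cball 0 (real n). dist (f s) (y + z) < e/2"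
      "\<exists>t\<in>S \<inter> cball 0 (real n). dist (f t) y < e/2"
      using half_gt_zero[OF e] unfolding A_def closure_approachable by blast+
    then obtain s t where s: "s \<in> S" "norm s \<le> n" "dist (f s) (y + z) < e/2"
      and t: "t \<in> S" "norm t \<le> n" "dist (f t) y < e/2"
      by (auto simp: dist_norm)
    have "norm (s - t) \<le> 2 * real n" using norm_triangle_ineq4[of s t] s t by linarith
    moreover have "norm (z - f (s - t)) < e"
    proof -
      have "z - f (s - t) = (f t - y) - (f s - (y + z))" by (simp add: f.diff)
      also have "norm \<dots> < e" using norm_triangle_ineq4[of "f t - y" "f s - (y + z)"] s t
        by (simp add: dist_norm)
      finally show ?thesis .
    qed
    ultimately show ?thesis using s t S by (meson subspace_diff)
  qed
  \<comment> \<open>The factor \<open>4\<close> comes from \<open>2 * real n\<close> and from scaling to norm \<open>r / 2\<close>; \<open>+ 1\<close> makes \<open>K\<close> positive if \<open>n = 0\<close>.\<close>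
  define K where "K = 4 * real n / r + 1"
  have "\<exists>s\<in>S. norm s \<le> K * norm x \<and> norm (x - f s) \<le> norm x / 2" for x
  proof (cases "x = 0")
    case True
    then show ?thesis using subspace_0[OF S] by (auto intro!: bexI[of _ 0] simp: f.zero)
  next
    case False
    define c where "c = r / (2 * norm x)"
    have c: "c > 0" using False r by (simp add: c_def)
    have "norm (c *\<^sub>R x) < r" using False r by (simp add: c_def)
    moreover have "c * norm x / 2 > 0" using c False by simp
    ultimately obtain s where s: "s \<in> S" "norm s \<le> 2 * real n" "norm (c *\<^sub>R x - f s) < c * norm x / 2"
      using small by blast
    have "norm (s /\<^sub>R c) \<le> (2 * real n) / c"
      using s c by (simp add: divide_simps)
    also have "\<dots> \<le> K * norm x"
      using r by (simp add: c_def K_def field_simps)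
    finally have 1: "norm (s /\<^sub>R c) \<le> K * norm x" .
    have "c * norm (x - f (s /\<^sub>R c)) = norm (c *\<^sub>R (x - f (s /\<^sub>R c)))" using c by simp
    also have "\<dots> = norm (c *\<^sub>R x - f s)" using c by (simp add: f.scaleR scaleR_diff_right)
    also have "\<dots> \<le> c * (norm x / 2)" using s by simp
    finally have "norm (x - f (s /\<^sub>R c)) \<le> norm x / 2" using c by simp
    then show ?thesis using 1 s S by (meson subspace_scale)
  qed
  moreover have "K > 0" using r by (simp add: K_def add_nonneg_pos)
  ultimately show ?thesis using that by blast
qed

text \<open>
  Successive approximation: the error left by an approximate preimage is at most half as large, so
  approximate preimages of the successive errors form a convergent series, and closedness of \<open>S\<close>
  makes its sum an exact preimage in \<open>S\<close>.
\<close>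

proposition open_mapping_bound:
  fixes f :: "'b::banach \<Rightarrow> 'a::banach"
  assumes f: "bounded_linear f" and S: "subspace S" "closed S" and surj: "f ` S = UNIV"
  obtains C where "\<And>x. \<exists>s\<in>S. f s = x \<and> norm s \<le> C * norm x"
proof -
  interpret f: bounded_linear f by fact
  obtain K where K: "K > 0" "\<And>x. \<exists>s\<in>S. norm s \<le> K * norm x \<and> norm (x - f s) \<le> norm x / 2"
    using bounded_linear_surj_imp_approx[OF f S(1) surj] by blast
  then obtain h where h: "\<And>x. h x \<in> S" "\<And>x. norm (h x) \<le> K * norm x"
    "\<And>x. norm (x - f (h x)) \<le> norm x / 2"
    by metis
  have "\<exists>s\<in>S. f s = x \<and> norm s \<le> 2 * K * norm x" for x
  proof -
    \<comment> \<open>the error that remains after \<open>k\<close> steps\<close>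
    define u where "u k = ((\<lambda>y. y - f (h y)) ^^ k) x" for k
    have u0: "u 0 = x" and uS: "u (Suc k) = u k - f (h (u k))" for k by (auto simp: u_def)
    have nu: "norm (u k) \<le> norm x * (1/2)^k" for k
    proof (induction k)
      case (Suc k)
      then show ?case using h(3)[of "u k"] by (simp add: uS)
    qed (simp add: u0)
    have nh: "norm (h (u k)) \<le> K * norm x * (1/2)^k" for k
      using h(2)[of "u k"] mult_left_mono[OF nu[of k], of K] K(1) by (simp only: mult.assoc) linarith
    have geo: "(\<lambda>k. K * norm x * (1/2)^k) sums (K * norm x * 2)"
      using geometric_sums[of "1/2::real"] by (intro sums_mult) simp
    have sn: "summable (\<lambda>k. norm (h (u k)))"
      by (rule summable_comparison_test'[OF sums_summable[OF geo], of 0]) (use nh in auto)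
    define s where "s = (\<Sum>k. h (u k))"
    have sums: "(\<lambda>k. h (u k)) sums s" unfolding s_def by (rule summable_sums[OF summable_norm_cancel[OF sn]])
    have "s \<in> S"
      by (rule closed_sequentially[OF S(2)]) (use sums h in \<open>auto simp: sums_def intro!: subspace_sum S\<close>)
    moreover have "norm s \<le> 2 * K * norm x"
    proof -
      have "norm s \<le> (\<Sum>k. norm (h (u k)))" unfolding s_def by (rule summable_norm[OF sn])
      also have "\<dots> \<le> K * norm x * 2" using suminf_le[OF nh sn sums_summable[OF geo]] sums_unique[OF geo]
        by simp
      finally show ?thesis by simp
    qed
    moreover have "f s = x"
    proof -
      have "(\<Sum>k<n. f (h (u k))) = x - u n" for n
        by (induction n) (auto simp: u0 uS)
      moreover have "u \<longlonglongrightarrow> 0"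
      proof (rule Lim_null_comparison)
        show "\<forall>\<^sub>F k in sequentially. norm (u k) \<le> norm x * (1/2)^k" using nu by simp
        show "(\<lambda>k. norm x * (1/2)^k) \<longlonglongrightarrow> 0"
          by (intro tendsto_mult_right_zero LIMSEQ_realpow_zero) auto
      qed
      ultimately have "(\<lambda>k. f (h (u k))) sums (x - 0)"
        unfolding sums_def by (simp only: tendsto_diff[OF tendsto_const])
      then show ?thesis using f.sums[OF sums] sums_unique2 by fastforce
    qed
    ultimately show ?thesis by blast
  qed
  then show ?thesis using that by blast
qed

section \<open>The Hahn-Banach theorem\<close>

text \<open>
  The one-step extension in the Hahn-Banach theorem, with a partial functional given by its graph \<open>G\<close>.
  A value \<open>c\<close> at \<open>y\<close> keeps the bound iff it lies between all \<open>r - norm (x - y)\<close> and all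
  \<open>norm (x + y) - r\<close>; the triangle inequality puts every number of the first kind below every number
  of the second kind.
\<close>

lemma norm_graph_extension:
  fixes G :: "('a::real_normed_vector \<times> real) set"
  assumes G: "subspace G" and dom: "\<And>x r. (x, r) \<in> G \<Longrightarrow> r \<le> norm x"
  obtains c where "\<And>x r t. (x, r) \<in> G \<Longrightarrow> r + t * c \<le> norm (x + t *\<^sub>R y)"
proof -
  define L where "L = {r - norm (x - y) | x r. (x, r) \<in> G}"
  define c where "c = Sup L"
  have G0: "(0, 0) \<in> G" using subspace_0[OF G] by (simp add: zero_prod_def)
  have gap: "l \<le> norm (x + y) - r" if "l \<in> L" "(x, r) \<in> G" for l x r
  proof -
    from that obtain x' r' where l: "l = r' - norm (x' - y)" "(x', r') \<in> G" by (auto simp: L_def)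
    have "r + r' \<le> norm (x + x')" using dom subspace_add[OF G that(2) l(2)] by simp
    also have "\<dots> \<le> norm (x + y) + norm (x' - y)" using norm_triangle_ineq[of "x + y" "x' - y"] by simp
    finally show ?thesis using l by simp
  qed
  have "L \<noteq> {}" using G0 by (auto simp: L_def)
  then have up: "c \<le> norm (x + y) - r" if "(x, r) \<in> G" for x r
    unfolding c_def using gap that by (intro cSup_least) auto
  have "bdd_above L" using gap[OF _ G0] by (auto simp: bdd_above_def)
  then have lo: "r - norm (x - y) \<le> c" if "(x, r) \<in> G" for x r
    unfolding c_def using that by (intro cSup_upper) (auto simp: L_def)
  have "r + t * c \<le> norm (x + t *\<^sub>R y)" if xr: "(x, r) \<in> G" for x r t
  proof -
    consider "t = 0" | "t > 0" | "t < 0" by linarith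
    then show ?thesis
    proof cases
      case 1 then show ?thesis using dom[OF xr] by simp
    next
      case 2
      have "(x /\<^sub>R t, r / t) \<in> G" using subspace_scale[OF G xr, of "inverse t"]
        by (simp add: divide_inverse mult.commute)
      from up[OF this] have "t * c \<le> t * (norm (x /\<^sub>R t + y) - r / t)" using 2 by simp
      also have "\<dots> = norm (t *\<^sub>R (x /\<^sub>R t + y)) - r"
        unfolding norm_scaleR using 2 by (simp add: field_simps)
      finally show ?thesis using 2 by (simp add: scaleR_add_right)
    next
      case 3
      define u where "u = - t"
      have u: "u > 0" "t = - u" using 3 by (auto simp: u_def)
      have "(x /\<^sub>R u, r / u) \<in> G" using subspace_scale[OF G xr, of "inverse u"]
        by (simp add: divide_inverse mult.commute)
      from lo[OF this] have "u * (r / u - norm (x /\<^sub>R u - y)) \<le> u * c" using u by simp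
      moreover have "u * (r / u - norm (x /\<^sub>R u - y)) = r - norm (u *\<^sub>R (x /\<^sub>R u - y))"
        unfolding norm_scaleR using u by (simp add: field_simps)
      ultimately show ?thesis using u by (simp add: scaleR_diff_right)
    qed
  qed
  then show ?thesis using that by blast
qed

text \<open>
  Zorn's lemma is applied to subspaces of the product with the reals that lie below the graph of the
  norm. The bound alone forces such a subspace to be the graph of a function, since \<open>(0, r)\<close> and
  \<open>(0, - r)\<close> both belong to it if one of them does. Hence maximality gives a total linear functional
  without any bookkeeping of domains.
\<close>

proposition Hahn_Banach_norming_functional:
  fixes x0 :: "'a::real_normed_vector"
  obtains f :: "'a \<Rightarrow> real" where "bounded_linear f" "f x0 = norm x0"
proof -
  define \<G> where "\<G> = {G. subspace G \<and> (x0, norm x0) \<in> G \<and> (\<forall>(x::'a, r)\<in>G. r \<le> norm x)}"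
  have "\<exists>M\<in>\<G>. \<forall>X\<in>\<G>. M \<subseteq> X \<longrightarrow> X = M"
  proof (rule subset_Zorn_nonempty)
    have "t * norm x0 \<le> norm (t *\<^sub>R x0)" for t by (simp add: mult_right_mono)
    then have "\<forall>(x, r)\<in>span {(x0, norm x0)}. r \<le> norm x" by (auto simp: span_singleton)
    then have "span {(x0, norm x0)} \<in> \<G>" by (auto simp: \<G>_def span_base)
    then show "\<G> \<noteq> {}" by blast
    fix \<C> assume \<C>: "\<C> \<noteq> {}" "subset.chain \<G> \<C>"
    have sub: "\<C> \<subseteq> \<G>" and lin: "\<And>X Y. X \<in> \<C> \<Longrightarrow> Y \<in> \<C> \<Longrightarrow> X \<subseteq> Y \<or> Y \<subseteq> X"
      using \<C>(2) by (auto simp: subset.chain_def)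
    have "subspace (\<Union>\<C>)"
    proof (rule subspaceI)
      show "0 \<in> \<Union>\<C>" using \<C>(1) sub by (auto simp: \<G>_def dest: subspace_0)
      show "p + q \<in> \<Union>\<C>" if pq: "p \<in> \<Union>\<C>" "q \<in> \<Union>\<C>" for p q
      proof -
        obtain X where "X \<in> \<C>" "p \<in> X" "q \<in> X" using pq lin by blast
        then show ?thesis using sub by (auto simp: \<G>_def intro: subspace_add)
      qed
      show "c *\<^sub>R p \<in> \<Union>\<C>" if "p \<in> \<Union>\<C>" for c p
        using that sub by (auto simp: \<G>_def intro: subspace_scale)
    qed
    then show "\<Union>\<C> \<in> \<G>" using \<C>(1) sub unfolding \<G>_def by blast
  qed
  then obtain M where M: "subspace M" "(x0, norm x0) \<in> M" and dom: "\<And>x r. (x, r) \<in> M \<Longrightarrow> r \<le> norm x"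
    and max: "\<And>X. X \<in> \<G> \<Longrightarrow> M \<subseteq> X \<Longrightarrow> X = M" by (auto simp: \<G>_def)
  have total: "\<exists>c. (y, c) \<in> M" for y
  proof -
    obtain c where c: "\<And>x r t. (x, r) \<in> M \<Longrightarrow> r + t * c \<le> norm (x + t *\<^sub>R y)"
      using norm_graph_extension[OF M(1) dom] by blast
    define X where "X = {p + q | p q. p \<in> M \<and> q \<in> span {(y, c)}}"
    have "subspace X" unfolding X_def by (intro subspace_sums M) auto
    have MX: "M \<subseteq> X"
    proof
      fix p assume "p \<in> M"
      then show "p \<in> X" unfolding X_def using span_zero[of "{(y, c)}"]
        by (metis (mono_tags, lifting) add.right_neutral mem_Collect_eq)
    qed
    have "(y, c) \<in> X"
      unfolding X_def using subspace_0[OF M(1)] span_base[of "(y, c)" "{(y, c)}"]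
      by (metis (mono_tags, lifting) add.left_neutral insertI1 mem_Collect_eq)
    moreover have "\<forall>(x, r)\<in>X. r \<le> norm x"
      unfolding X_def span_singleton using c by auto
    then have "X \<in> \<G>" unfolding \<G>_def using \<open>subspace X\<close> MX M(2) by auto
    ultimately show ?thesis using max MX by blast
  qed
  then obtain f where f: "\<And>y. (y, f y) \<in> M" by metis
  have uniq: "r = f y" if "(y, r) \<in> M" for y r
    using dom[of 0 "r - f y"] dom[of 0 "f y - r"] subspace_diff[OF M(1) that f[of y]] subspace_diff[OF M(1) f[of y] that]
    by auto
  have "bounded_linear f"
  proof (rule bounded_linear_intro[where K = 1])
    show "f (x + y) = f x + f y" for x y
      using uniq[of "x + y" "f x + f y"] subspace_add[OF M(1) f[of x] f[of y]] by simp
    show sc: "f (t *\<^sub>R x) = t *\<^sub>R f x" for t x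
      using uniq[of "t *\<^sub>R x" "t * f x"] subspace_scale[OF M(1) f[of x], of t] by simp
    show "norm (f x) \<le> norm x * 1" for x
      using dom[OF f[of x]] dom[OF f[of "-x"]] sc[of "-1" x] by simp
  qed
  moreover have "f x0 = norm x0" using uniq[OF M(2)] by simp
  ultimately show ?thesis using that by blast
qed

section \<open>Sums of subspaces and finite-dimensional perturbations\<close>

lemma csubspace_imp_subspace: "csubspace S \<Longrightarrow> subspace S"
  by (metis complex_vector.subspace_0 complex_vector.subspace_add complex_vector.subspace_scale
      scaleC_of_real subspaceI)

lemma sums_eq_set_plus: "{x + y | x y. x \<in> A \<and> y \<in> B} = A + B"
  by (auto simp: set_plus_def)

lemma csubspace_plus: "csubspace A \<Longrightarrow> csubspace B \<Longrightarrow> csubspace (A + B)"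
  using complex_vector.subspace_sums[of A B] by (simp add: sums_eq_set_plus)

lemma subset_plus_left: "csubspace B \<Longrightarrow> A \<subseteq> A + B"
  using complex_vector.subspace_0[of B] by (force simp: set_plus_def)

lemma cfinite_dim_imp_csubspace: "cfinite_dim V \<Longrightarrow> csubspace V"
  by (auto simp: cfinite_dim_def)

lemma cfinite_dim_cspan: "finite B \<Longrightarrow> cfinite_dim (cspan B)"
  by (auto simp: cfinite_dim_def)

lemma cspan_plus: "cspan A + cspan B = cspan (A \<union> B)"
  by (simp add: complex_vector.span_Un sums_eq_set_plus)

lemma cfinite_dim_plus: "cfinite_dim V \<Longrightarrow> cfinite_dim W \<Longrightarrow> cfinite_dim (V + W)"
  unfolding cfinite_dim_def using cspan_plus finite_UnI by blast

lemma cfinite_dim_subset: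
  assumes U: "csubspace U" and "U \<subseteq> V" "cfinite_dim V"
  shows "cfinite_dim U"
proof -
  obtain B where B: "finite B" "V = cspan B" using assms by (auto simp: cfinite_dim_def)
  obtain C where C: "C \<subseteq> U" "complex_vector.independent C" "U \<subseteq> cspan C"
    using complex_vector.maximal_independent_subset by blast
  have "finite C"
    using complex_vector.independent_span_bound[OF B(1) C(2)] C(1) assms(2) B(2) by blast
  moreover have "cspan C = U"
    using C complex_vector.span_minimal[OF C(1) U] by blast
  ultimately show ?thesis by (auto simp: cfinite_dim_def)
qed

lemma clinear_cspan_image:
  assumes "bounded_clinear f"
  shows "f ` cspan B = cspan (f ` B)"
proof -
  interpret f: bounded_linear f using assms by (simp add: bounded_clinear_def)
  interpret module_hom "scaleC :: complex \<Rightarrow> 'a \<Rightarrow> 'a" "scaleC :: complex \<Rightarrow> 'b \<Rightarrow> 'b" f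
    using assms by unfold_locales
      (simp_all add: scaleC_add_right scaleC_add_left scaleC_scaleC scaleC_one f.add bounded_clinear_def)
  show ?thesis unfolding cspan_def by (rule span_image[symmetric])
qed

lemma cfinite_dim_image: "bounded_clinear f \<Longrightarrow> cfinite_dim V \<Longrightarrow> cfinite_dim (f ` V)"
  unfolding cfinite_dim_def by (metis clinear_cspan_image finite_imageI)

text \<open>
  Lift a finite spanning set of the image.
\<close>

lemma cfinite_dim_image_decomposition:
  assumes f: "bounded_clinear f" and "cfinite_dim (f ` M)"
  obtains G where "cfinite_dim G" "M \<subseteq> null_space f + G"
proof -
  interpret f: bounded_linear f using f by (simp add: bounded_clinear_def)
  obtain B where B: "finite B" "f ` M = cspan B" using assms by (auto simp: cfinite_dim_def)
  then have "B \<subseteq> f ` M" using complex_vector.span_superset by metis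
  then obtain B' where B': "finite B'" "B = f ` B'" using B(1) finite_subset_image by metis
  have "M \<subseteq> null_space f + cspan B'"
  proof
    fix x assume "x \<in> M"
    then have "f x \<in> f ` cspan B'" using B B' clinear_cspan_image[OF f] by blast
    then obtain y where y: "y \<in> cspan B'" "f x = f y" by blast
    then have "x - y \<in> null_space f" by (simp add: null_space_def f.diff)
    then have "(x - y) + y \<in> null_space f + cspan B'" using y(1) by (rule set_plus_intro)
    then show "x \<in> null_space f + cspan B'" by simp
  qed
  then show ?thesis using that cfinite_dim_cspan[OF B'(1)] by blast
qed

text \<open>
  If some \<open>a \<in> A\<close> is congruent to \<open>b\<close> modulo \<open>B\<close>, then it accounts for the only new direction that the
  intersection can gain; otherwise the intersection does not grow.
\<close>

lemma cfinite_dim_Int_plus_line: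
  assumes A: "csubspace A" and B: "csubspace B" and fin: "cfinite_dim (A \<inter> B)"
  shows "cfinite_dim (A \<inter> (B + cspan {b}))"
proof (cases "\<exists>a\<in>A. a - b \<in> B")
  case True
  then obtain a where a: "a \<in> A" "a - b \<in> B" by blast
  have "A \<inter> (B + cspan {b}) \<subseteq> (A \<inter> B) + cspan {a}"
  proof
    fix x assume "x \<in> A \<inter> (B + cspan {b})"
    then obtain \<beta> c where x: "x \<in> A" "x = \<beta> + c *\<^sub>C b" "\<beta> \<in> B"
      by (auto simp: set_plus_def complex_vector.span_singleton)
    have "x - c *\<^sub>C a \<in> A" using x a A by (simp add: complex_vector.subspace_diff complex_vector.subspace_scale)
    moreover have "x - c *\<^sub>C a = \<beta> - c *\<^sub>C (a - b)" by (simp add: x complex_vector.scale_right_diff_distrib)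
    moreover have "\<dots> \<in> B"
      by (intro complex_vector.subspace_diff complex_vector.subspace_scale B x(3) a(2))
    ultimately have "x - c *\<^sub>C a \<in> A \<inter> B" by simp
    moreover have "c *\<^sub>C a \<in> cspan {a}" by (intro complex_vector.span_scale complex_vector.span_base) simp
    ultimately have "(x - c *\<^sub>C a) + c *\<^sub>C a \<in> (A \<inter> B) + cspan {a}" by (rule set_plus_intro)
    then show "x \<in> (A \<inter> B) + cspan {a}" by simp
  qed
  moreover have "cfinite_dim ((A \<inter> B) + cspan {a})"
    by (intro cfinite_dim_plus fin cfinite_dim_cspan) auto
  ultimately show ?thesis
    by (rule cfinite_dim_subset[rotated])
      (intro complex_vector.subspace_inter csubspace_plus A B complex_vector.subspace_span)
next
  case False
  have "A \<inter> (B + cspan {b}) \<subseteq> A \<inter> B"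
  proof
    fix x assume "x \<in> A \<inter> (B + cspan {b})"
    then obtain \<beta> c where x: "x \<in> A" "x = \<beta> + c *\<^sub>C b" "\<beta> \<in> B"
      by (auto simp: set_plus_def complex_vector.span_singleton)
    have "c = 0"
    proof (rule ccontr)
      assume c: "c \<noteq> 0"
      have "inverse c *\<^sub>C x - b = inverse c *\<^sub>C \<beta>"
        using c by (simp add: x scaleC_add_right scaleC_scaleC scaleC_one)
      also have "\<dots> \<in> B" by (intro complex_vector.subspace_scale B x(3))
      finally show False using False complex_vector.subspace_scale[OF A x(1)] by blast
    qed
    then show "x \<in> A \<inter> B" using x by simp
  qed
  then show ?thesis
    using fin by (rule cfinite_dim_subset[rotated])
      (intro complex_vector.subspace_inter csubspace_plus A B complex_vector.subspace_span)
qed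

text \<open>
  By adding the generators of \<open>G\<close> one at a time. Through this lemma finite-dimensional errors are ignored
  in all later intersections.
\<close>

lemma cfinite_dim_Int_plus:
  assumes A: "csubspace A" and B: "csubspace B" and fin: "cfinite_dim (A \<inter> B)" and G: "cfinite_dim G"
  shows "cfinite_dim (A \<inter> (B + G))"
proof -
  obtain S where S: "finite S" "G = cspan S" using G by (auto simp: cfinite_dim_def)
  from S(1) B fin have "cfinite_dim (A \<inter> (B + cspan S))"
  proof (induction S arbitrary: B rule: finite_induct)
    case empty
    have "B + {0} = B" by (auto simp: set_plus_def)
    then show ?case using empty.prems by simp
  next
    case (insert b S)
    have "cfinite_dim (A \<inter> ((B + cspan {b}) + cspan S))"
    proof (rule insert.IH)
      show "csubspace (B + cspan {b})"
        by (intro csubspace_plus insert.prems complex_vector.subspace_span)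
      show "cfinite_dim (A \<inter> (B + cspan {b}))"
        by (intro cfinite_dim_Int_plus_line A insert.prems)
    qed
    moreover have "(B + cspan {b}) + cspan S = B + cspan (insert b S)"
      by (metis add.assoc cspan_plus insert_is_Un)
    ultimately show ?case by simp
  qed
  then show ?thesis by (simp add: S)
qed

section \<open>Bounded complex-linear operators\<close>

lemma bounded_clinearI:
  assumes "bounded_linear f" "\<And>c x. f (c *\<^sub>C x) = c *\<^sub>C f x"
  shows "bounded_clinear f"
  using assms by (simp add: bounded_clinear_def)

lemma bounded_clinear_imp_bounded_linear: "bounded_clinear f \<Longrightarrow> bounded_linear f"
  by (simp add: bounded_clinear_def)

lemma bounded_clinear_compose: "bounded_clinear f \<Longrightarrow> bounded_clinear g \<Longrightarrow> bounded_clinear (\<lambda>x. f (g x))"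
  by (simp add: bounded_clinear_def bounded_linear_compose)

lemma bounded_clinear_funpow:
  fixes f :: "'a::complex_normed_vector \<Rightarrow> 'a"
  shows "bounded_clinear f \<Longrightarrow> bounded_clinear (f ^^ n)"
proof (induction n)
  case 0
  have "f ^^ 0 = (\<lambda>x. x)" by auto
  then show ?case by (simp only: bounded_clinear_def bounded_linear_ident) simp
next
  case (Suc n)
  then show ?case using bounded_clinear_compose[of f "f ^^ n"] by (simp add: o_def)
qed

lemma csubspace_image:
  assumes "bounded_clinear f" "csubspace S"
  shows "csubspace (f ` S)"
proof -
  have "cspan S = S" using assms(2) by (rule complex_vector.span_eq_iff[THEN iffD2])
  then have "f ` S = cspan (f ` S)" using clinear_cspan_image[OF assms(1), of S] by metis
  then show ?thesis by (metis complex_vector.subspace_span)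
qed

lemma csubspace_vimage:
  assumes "bounded_clinear f" "csubspace S"
  shows "csubspace (f -` S)"
proof -
  interpret f: bounded_linear f using assms by (simp add: bounded_clinear_def)
  have c: "f (c *\<^sub>C x) = c *\<^sub>C f x" for c x using assms(1) by (simp add: bounded_clinear_def)
  show ?thesis
    by (rule complex_vector.subspaceI)
      (simp_all add: f.zero f.add c complex_vector.subspace_0[OF assms(2)]
        complex_vector.subspace_add[OF assms(2)] complex_vector.subspace_scale[OF assms(2)])
qed

lemma closed_vimage_bounded_clinear: "bounded_clinear f \<Longrightarrow> closed S \<Longrightarrow> closed (f -` S)"
  by (intro closed_vimage linear_continuous_on bounded_clinear_imp_bounded_linear)

lemma null_space_eq_vimage: "null_space f = f -` {0}"
  by (auto simp: null_space_def)

lemma csubspace_null_space: "bounded_clinear f \<Longrightarrow> csubspace (null_space f)"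
  by (simp add: null_space_eq_vimage csubspace_vimage)

lemma closed_null_space: "bounded_clinear f \<Longrightarrow> closed (null_space f)"
  by (simp add: null_space_eq_vimage closed_vimage_bounded_clinear)

lemma csubspace_range: "bounded_clinear f \<Longrightarrow> csubspace (range f)"
  by (simp add: csubspace_image)

section \<open>Projections onto finite-dimensional subspaces\<close>

text \<open>
  A real functional \<open>f\<close> is the real part of the complex-linear functional \<open>x \<mapsto> f x - \<i> * f (\<i> *\<^sub>C x)\<close>.
\<close>

lemma exists_separating_clinear_functional:
  fixes x0 :: "'a::complex_normed_vector"
  assumes "x0 \<noteq> 0"
  obtains \<phi> :: "'a \<Rightarrow> complex"
    where "bounded_linear \<phi>" "\<And>c x. \<phi> (c *\<^sub>C x) = c * \<phi> x" "\<phi> x0 \<noteq> 0"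
proof -
  obtain f :: "'a \<Rightarrow> real" where f: "bounded_linear f" "f x0 = norm x0"
    using Hahn_Banach_norming_functional by blast
  interpret f: bounded_linear f by fact
  define \<phi> where "\<phi> x = complex_of_real (f x) - \<i> * complex_of_real (f (\<i> *\<^sub>C x))" for x
  have real: "r *\<^sub>R x = complex_of_real r *\<^sub>C x" for r and x :: 'a by (simp add: scaleC_of_real)
  have add: "\<phi> (x + y) = \<phi> x + \<phi> y" for x y
    by (simp add: \<phi>_def scaleC_add_right f.add algebra_simps)
  have sc: "\<phi> (r *\<^sub>R x) = complex_of_real r * \<phi> x" for r x
  proof -
    have "\<i> *\<^sub>C r *\<^sub>R x = r *\<^sub>R (\<i> *\<^sub>C x)" by (simp add: real scaleC_scaleC mult.commute)
    then show ?thesis by (simp add: \<phi>_def f.scaleR algebra_simps)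
  qed
  have i: "\<phi> (\<i> *\<^sub>C x) = \<i> * \<phi> x" for x
  proof -
    have "\<i> *\<^sub>C \<i> *\<^sub>C x = (-1) *\<^sub>R x" by (simp add: real scaleC_scaleC del: scaleR_minus1_left)
    then show ?thesis by (simp add: \<phi>_def f.neg algebra_simps)
  qed
  have c: "\<phi> (c *\<^sub>C x) = c * \<phi> x" for c x
  proof -
    have "c *\<^sub>C x = Re c *\<^sub>R x + Im c *\<^sub>R (\<i> *\<^sub>C x)"
      unfolding real scaleC_scaleC scaleC_add_left[symmetric] by (metis complex_eq mult.commute)
    then have "\<phi> (c *\<^sub>C x) = (complex_of_real (Re c) + \<i> * complex_of_real (Im c)) * \<phi> x"
      by (simp only: add sc i) (simp add: algebra_simps)
    then show ?thesis by (metis complex_eq)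
  qed
  obtain K where K: "\<And>x. norm (f x) \<le> norm x * K" using f.bounded by blast
  have "bounded_linear \<phi>"
  proof (rule bounded_linear_intro[where K = "2 * K"])
    show "norm (\<phi> x) \<le> norm x * (2 * K)" for x
    proof -
      have "norm (\<phi> x) \<le> norm (f x) + norm (f (\<i> *\<^sub>C x))"
        unfolding \<phi>_def by (rule order_trans[OF norm_triangle_ineq4]) (simp add: norm_mult)
      also have "\<dots> \<le> norm x * (2 * K)" using K[of x] K[of "\<i> *\<^sub>C x"] by (simp add: norm_scaleC)
      finally show ?thesis .
    qed
  qed (simp_all only: add sc scaleR_conv_of_real)
  moreover have "\<phi> x0 \<noteq> 0"
    using f(2) assms by (auto simp: \<phi>_def complex_eq_iff)
  ultimately show ?thesis using that c by blast
qed

text \<open>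
  By induction on a spanning set. Given the projection \<open>P\<close> onto the span so far and a new vector \<open>b\<close>, only
  \<open>b' = b - P b\<close> is new. A functional \<open>\<phi>\<close> that does not vanish at \<open>b'\<close> yields
  \<open>\<psi> x = \<phi> (x - P x) / \<phi> b'\<close>, which is \<open>0\<close> on the old span and \<open>1\<close> at \<open>b'\<close>, so that \<open>P + \<psi> b'\<close>
  is the new projection.
\<close>

lemma cfinite_dim_projection:
  fixes F :: "'a::complex_normed_vector set"
  assumes "cfinite_dim F"
  obtains P where "bounded_clinear P" "\<And>x. P x \<in> F" "\<And>x. x \<in> F \<Longrightarrow> P x = x"
proof -
  obtain B where B: "finite B" "F = cspan B" using assms by (auto simp: cfinite_dim_def)
  from B(1) have "\<exists>P. bounded_clinear P \<and> (\<forall>x. P x \<in> cspan B) \<and> (\<forall>x\<in>cspan B. P x = x)"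
  proof (induction B rule: finite_induct)
    case empty
    then show ?case by (intro exI[of _ "\<lambda>_. 0"]) (simp add: bounded_clinear_def bounded_linear_zero)
  next
    case (insert b B)
    then obtain P where P: "bounded_clinear P" "\<And>x. P x \<in> cspan B" "\<And>x. x \<in> cspan B \<Longrightarrow> P x = x" by blast
    interpret P: bounded_linear P using P by (simp add: bounded_clinear_def)
    have Pc: "P (c *\<^sub>C x) = c *\<^sub>C P x" for c x using P by (simp add: bounded_clinear_def)
    have sub: "cspan B \<subseteq> cspan (insert b B)" by (intro complex_vector.span_mono) auto
    define b' where "b' = b - P b"
    have b'_in: "b' \<in> cspan (insert b B)"
      unfolding b'_def using sub P(2) by (intro complex_vector.span_diff) (auto intro: complex_vector.span_base)
    have Pb': "P b' = 0" using P(3)[OF P(2)[of b]] by (simp add: b'_def P.diff)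
    have decomp: "\<exists>c u. u \<in> cspan B \<and> x = u + c *\<^sub>C b'" if x: "x \<in> cspan (insert b B)" for x
    proof -
      obtain c where c: "x - c *\<^sub>C b \<in> cspan B" using x unfolding complex_vector.span_breakdown_eq by blast
      have "x = ((x - c *\<^sub>C b) + c *\<^sub>C P b) + c *\<^sub>C b'"
        unfolding b'_def complex_vector.scale_right_diff_distrib by simp
      moreover have "(x - c *\<^sub>C b) + c *\<^sub>C P b \<in> cspan B"
        by (intro complex_vector.span_add complex_vector.span_scale c P(2))
      ultimately show ?thesis by blast
    qed
    show ?case
    proof (cases "b' = 0")
      case True
      then have "P x = x" if "x \<in> cspan (insert b B)" for x using decomp[OF that] P(3) by auto
      then show ?thesis using P sub by blast
    next
      case False
      then obtain \<phi> :: "'a \<Rightarrow> complex" where \<phi>: "bounded_linear \<phi>" "\<And>c x. \<phi> (c *\<^sub>C x) = c * \<phi> x" "\<phi> b' \<noteq> 0"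
        using exists_separating_clinear_functional by blast
      interpret \<phi>: bounded_linear \<phi> by fact
      define \<psi> where "\<psi> x = \<phi> (x - P x) / \<phi> b'" for x
      define Q where "Q x = P x + \<psi> x *\<^sub>C b'" for x
      have "bounded_linear (\<lambda>x. x - P x)" by (intro bounded_linear_sub bounded_linear_ident P.bounded_linear_axioms)
      then have "bounded_linear \<psi>"
        unfolding \<psi>_def divide_inverse by (intro bounded_linear_mult_const bounded_linear_compose[OF \<phi>(1)])
      then interpret \<psi>: bounded_linear \<psi> .
      have \<psi>c: "\<psi> (c *\<^sub>C x) = c * \<psi> x" for c x
        by (simp add: \<psi>_def Pc \<phi>(2) flip: complex_vector.scale_right_diff_distrib)
      obtain K where K: "\<And>x. norm (\<psi> x) \<le> norm x * K" using \<psi>.bounded by blast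
      have "bounded_linear (\<lambda>x. \<psi> x *\<^sub>C b')"
      proof (rule bounded_linear_intro[where K = "K * norm b'"])
        show "norm (\<psi> x *\<^sub>C b') \<le> norm x * (K * norm b')" for x
          using mult_right_mono[OF K[of x], of "norm b'"] by (simp add: norm_scaleC mult.assoc)
        show "\<psi> (r *\<^sub>R x) *\<^sub>C b' = r *\<^sub>R (\<psi> x *\<^sub>C b')" for r x
        proof -
          have "\<psi> (r *\<^sub>R x) = complex_of_real r * \<psi> x"
            by (simp only: \<psi>.scaleR scaleR_conv_of_real)
          then show ?thesis by (simp only: scaleC_of_real[symmetric] scaleC_scaleC)
        qed
      qed (simp add: \<psi>.add scaleC_add_left)
      then have "bounded_linear Q" unfolding Q_def by (intro bounded_linear_add P.bounded_linear_axioms)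
      moreover have "Q (c *\<^sub>C x) = c *\<^sub>C Q x" for c x
        by (simp add: Q_def Pc \<psi>c scaleC_add_right scaleC_scaleC)
      ultimately have "bounded_clinear Q" by (rule bounded_clinearI)
      moreover have "Q x \<in> cspan (insert b B)" for x
        unfolding Q_def using sub P(2) b'_in by (intro complex_vector.span_add complex_vector.span_scale) auto
      moreover have "Q x = x" if x: "x \<in> cspan (insert b B)" for x
      proof -
        obtain c u where u: "u \<in> cspan B" "x = u + c *\<^sub>C b'" using decomp[OF x] by blast
        have "P x = u" by (simp add: u P.add P(3) Pc Pb')
        moreover have "\<psi> x = c" using \<phi>(3) \<open>P x = u\<close> by (simp add: \<psi>_def u(2) \<phi>(2))
        ultimately show ?thesis by (simp add: Q_def u(2))
      qed
      ultimately show ?thesis by blast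
    qed
  qed
  then show ?thesis using that B by blast
qed

lemma cfinite_dim_closed:
  fixes F :: "'a::complex_normed_vector set"
  assumes "cfinite_dim F"
  shows "closed F"
proof -
  obtain P where P: "bounded_clinear P" "\<And>x. P x \<in> F" "\<And>x. x \<in> F \<Longrightarrow> P x = x"
    using cfinite_dim_projection[OF assms] by blast
  have "x \<in> F \<longleftrightarrow> P x = x" for x using P(2)[of x] P(3)[of x] by auto
  then have "F = {x. P x = x}" by blast
  also have "closed \<dots>"
    by (intro closed_Collect_eq continuous_on_id linear_continuous_on bounded_clinear_imp_bounded_linear P(1))
  finally show ?thesis .
qed

section \<open>Complemented operator ranges\<close>

lemma topologically_complementedI_projection:
  assumes P: "bounded_clinear P" and M: "csubspace M" and N: "csubspace N"
    and PM: "\<And>x. P x \<in> M" and PN: "\<And>x. x - P x \<in> N" and MN: "M \<inter> N = {0}"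
  shows "topologically_complemented M"
proof -
  interpret P: bounded_linear P using P by (simp add: bounded_clinear_def)
  have Q: "bounded_clinear (\<lambda>x. x - P x)"
    using P by (auto simp: bounded_clinear_def complex_vector.scale_right_diff_distrib
        intro: bounded_linear_sub bounded_linear_ident)
  have "P x = x" if "x \<in> M" for x
  proof -
    have "x - P x \<in> M \<inter> N" using complex_vector.subspace_diff[OF M that PM[of x]] PN[of x] by simp
    then show ?thesis using MN by simp
  qed
  then have "x \<in> M \<longleftrightarrow> x - P x = 0" for x using PM[of x] by force
  then have M_eq: "M = null_space (\<lambda>x. x - P x)" by (auto simp: null_space_def)
  have "P x = 0" if "x \<in> N" for x
  proof -
    have "x - (x - P x) \<in> M \<inter> N" using complex_vector.subspace_diff[OF N that PN[of x]] PM[of x] by simp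
    then show ?thesis using MN by simp
  qed
  then have "x \<in> N \<longleftrightarrow> P x = 0" for x using PN[of x] by force
  then have N_eq: "N = null_space P" by (auto simp: null_space_def)
  have "x \<in> M + N" for x using set_plus_intro[OF PM PN, of x x] by simp
  then have "M + N = UNIV" by blast
  moreover have "closed M" unfolding M_eq by (rule closed_null_space[OF Q])
  moreover have "closed N" unfolding N_eq by (rule closed_null_space[OF P])
  ultimately show ?thesis
    unfolding topologically_complemented_def sums_eq_set_plus using M N MN by blast
qed

lemma bounded_linear_sum_on_product:
  fixes f :: "'b::real_normed_vector \<Rightarrow> 'a::real_normed_vector" and g :: "'c::real_normed_vector \<Rightarrow> 'a"
  assumes "bounded_linear f" "bounded_linear g"
  shows "bounded_linear (\<lambda>p. f (fst p) + g (snd p))"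
  by (intro bounded_linear_add bounded_linear_compose[OF assms(1)] bounded_linear_compose[OF assms(2)]
      bounded_linear_fst bounded_linear_snd)

lemma image_sum_on_product: "(\<lambda>p. f (fst p) + g (snd p)) ` (S \<times> S') = f ` S + g ` S'"
  by (force simp: set_plus_def)

text \<open>
  The open mapping theorem applied to \<open>(s, s') \<mapsto> f s + g s'\<close> decomposes every \<open>x\<close> with norm control. The
  component in \<open>f ` S\<close> is unique although \<open>s\<close> need not be, so it is a bounded projection.
\<close>

proposition topologically_complemented_if_algebraic_complement:
  fixes f :: "'b::banach \<Rightarrow> 'a::complex_banach" and g :: "'c::banach \<Rightarrow> 'a"
  assumes f: "bounded_linear f" "subspace S" "closed S" and g: "bounded_linear g" "subspace S'" "closed S'"
    and M: "csubspace (f ` S)" and N: "csubspace (g ` S')"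
    and MN: "f ` S \<inter> g ` S' = {0}" and UN: "f ` S + g ` S' = UNIV"
  shows "topologically_complemented (f ` S)"
proof -
  interpret f: bounded_linear f by fact
  interpret g: bounded_linear g by fact
  obtain C where C: "\<And>x. \<exists>p\<in>S \<times> S'. f (fst p) + g (snd p) = x \<and> norm p \<le> C * norm x"
    using open_mapping_bound[OF bounded_linear_sum_on_product[OF f(1) g(1)]
        subspace_Times[OF f(2) g(2)] closed_Times[OF f(3) g(3)]] UN
    unfolding image_sum_on_product by blast
  then obtain \<sigma> where \<sigma>: "\<And>x. \<sigma> x \<in> S \<times> S'" "\<And>x. f (fst (\<sigma> x)) + g (snd (\<sigma> x)) = x"
    "\<And>x. norm (\<sigma> x) \<le> C * norm x" by metis
  define P where "P x = f (fst (\<sigma> x))" for x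
  have PM: "P x \<in> f ` S" for x using \<sigma>(1)[of x] by (auto simp: P_def)
  have PN: "x - P x \<in> g ` S'" for x
  proof -
    have "x - P x = g (snd (\<sigma> x))" unfolding P_def using \<sigma>(2)[of x] by (metis add_diff_cancel_left')
    then show ?thesis using \<sigma>(1)[of x] by auto
  qed
  \<comment> \<open>\<open>P\<close> is defined by a choice; uniqueness of the decomposition makes it linear.\<close>
  have uniq: "P x = m" if "m \<in> f ` S" "x - m \<in> g ` S'" for x m
  proof -
    have "P x - m \<in> f ` S" using complex_vector.subspace_diff[OF M PM that(1)] .
    moreover have "(x - m) - (x - P x) \<in> g ` S'" using complex_vector.subspace_diff[OF N that(2) PN] .
    then have "P x - m \<in> g ` S'" by simp
    ultimately have "P x - m \<in> {0}" unfolding MN[symmetric] by (rule IntI)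
    then show ?thesis by simp
  qed
  have add: "P (x + y) = P x + P y" for x y
  proof (rule uniq)
    show "P x + P y \<in> f ` S" by (rule complex_vector.subspace_add[OF M PM PM])
    have "(x - P x) + (y - P y) \<in> g ` S'" by (rule complex_vector.subspace_add[OF N PN PN])
    then show "x + y - (P x + P y) \<in> g ` S'" by (simp add: algebra_simps)
  qed
  have scale: "P (c *\<^sub>C x) = c *\<^sub>C P x" for c x
  proof (rule uniq)
    show "c *\<^sub>C P x \<in> f ` S" by (rule complex_vector.subspace_scale[OF M PM])
    have "c *\<^sub>C (x - P x) \<in> g ` S'" by (rule complex_vector.subspace_scale[OF N PN])
    then show "c *\<^sub>C x - c *\<^sub>C P x \<in> g ` S'" by (simp add: complex_vector.scale_right_diff_distrib)
  qed
  obtain K where K: "K > 0" "\<And>s. norm (f s) \<le> norm s * K" using f.pos_bounded by blast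
  have "bounded_linear P"
  proof (rule bounded_linear_intro[where K = "C * K"])
    show "norm (P x) \<le> norm x * (C * K)" for x
    proof -
      have "norm (P x) \<le> norm (fst (\<sigma> x)) * K" unfolding P_def by (rule K(2))
      also have "\<dots> \<le> (C * norm x) * K"
        using K(1) norm_fst_le[of "fst (\<sigma> x)" "snd (\<sigma> x)"] \<sigma>(3)[of x]
        by (intro mult_right_mono) auto
      finally show ?thesis by (simp add: mult_ac)
    qed
    show "P (r *\<^sub>R x) = r *\<^sub>R P x" for r x using scale[of "complex_of_real r" x] by (simp add: scaleC_of_real)
  qed (rule add)
  then have "bounded_clinear P" using scale by (rule bounded_clinearI)
  then show ?thesis using M N PM PN MN by (rule topologically_complementedI_projection)
qed

text \<open>
  Removing the intersection from one side makes the sum direct: with a projection \<open>P\<close> onto it,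
  \<open>g ` S'\<close> is replaced by its part in the kernel of \<open>P\<close>, which is the image of a closed subspace again.
\<close>

proposition topologically_complemented_if_Fredholm_pair:
  fixes f :: "'b::banach \<Rightarrow> 'a::complex_banach" and g :: "'c::banach \<Rightarrow> 'a"
  assumes f: "bounded_linear f" "subspace S" "closed S" and g: "bounded_linear g" "subspace S'" "closed S'"
    and M: "csubspace (f ` S)" and N: "csubspace (g ` S')"
    and fin: "cfinite_dim (f ` S \<inter> g ` S')" and UN: "f ` S + g ` S' = UNIV"
  shows "topologically_complemented (f ` S)"
proof -
  obtain P where P: "bounded_clinear P" "\<And>x. P x \<in> f ` S \<inter> g ` S'"
    "\<And>x. x \<in> f ` S \<inter> g ` S' \<Longrightarrow> P x = x"
    using cfinite_dim_projection[OF fin] by blast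
  interpret P: bounded_linear P using P by (simp add: bounded_clinear_def)
  define S'' where "S'' = S' \<inter> {s. P (g s) = 0}"
  interpret Pg: bounded_linear "\<lambda>s. P (g s)"
    by (rule bounded_linear_compose[OF P.bounded_linear_axioms g(1)])
  have "subspace {s. P (g s) = 0}"
    by (rule subspaceI) (simp_all add: Pg.add Pg.scaleR Pg.zero)
  then have S'': "subspace S''" unfolding S''_def by (intro subspace_inter g)
  have "closed {s. P (g s) = 0}"
    by (intro closed_Collect_eq continuous_on_const linear_continuous_on Pg.bounded_linear_axioms)
  then have clS'': "closed S''" unfolding S''_def by (intro closed_Int g)
  have img: "g ` S'' = g ` S' \<inter> null_space P"
    by (auto simp: S''_def null_space_def)
  show ?thesis
  proof (rule topologically_complemented_if_algebraic_complement[OF f g(1) S'' clS'' M])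
    show "csubspace (g ` S'')"
      unfolding img by (intro complex_vector.subspace_inter N csubspace_null_space P(1))
    have "0 \<in> f ` S \<inter> g ` S''" unfolding img
      using complex_vector.subspace_0[OF M] complex_vector.subspace_0[OF N] by (simp add: null_space_def P.zero)
    moreover have "x = 0" if "x \<in> f ` S \<inter> g ` S''" for x
      using that P(3)[of x] by (simp add: img null_space_def)
    ultimately show "f ` S \<inter> g ` S'' = {0}" by blast
    have "x \<in> f ` S + g ` S''" for x
    proof -
      have "x \<in> f ` S + g ` S'" using UN by simp
      then obtain m n where x: "m \<in> f ` S" "n \<in> g ` S'" "x = m + n" by (auto simp: set_plus_def)
      have "m + P n \<in> f ` S" using complex_vector.subspace_add[OF M x(1), of "P n"] P(2) by blast
      moreover have "n - P n \<in> g ` S''"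
        unfolding img using complex_vector.subspace_diff[OF N x(2), of "P n"] P(2) P(3)[OF P(2)]
        by (simp add: null_space_def P.diff)
      ultimately have "(m + P n) + (n - P n) \<in> f ` S + g ` S''" by (rule set_plus_intro)
      then show ?thesis by (simp add: x)
    qed
    then show "f ` S + g ` S'' = UNIV" by blast
  qed
qed

text \<open>
  The form used below: the operator ranges are \<open>f ` A + B\<close> and \<open>g ` C + D\<close>, both images of products of
  closed subspaces, and \<open>G\<close> absorbs a finite-dimensional defect of their sum.
\<close>

proposition topologically_complemented_if_finite_overlap:
  fixes f g :: "'a::complex_banach \<Rightarrow> 'a"
  assumes f: "bounded_clinear f" and A: "csubspace A" "closed A" and B: "csubspace B" "closed B"
    and g: "bounded_clinear g" and C: "csubspace C" "closed C" and D: "csubspace D" "closed D"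
    and G: "cfinite_dim G"
    and fin: "cfinite_dim ((f ` A + B) \<inter> (g ` C + D))" and UN: "(f ` A + B) + (g ` C + D) + G = UNIV"
  shows "topologically_complemented (f ` A + B)"
proof -
  let ?f = "\<lambda>p. f (fst p) + snd p"
  let ?g = "\<lambda>p. (g (fst (fst p)) + snd (fst p)) + snd p"
  have bf: "bounded_linear ?f"
    by (rule bounded_linear_sum_on_product[OF bounded_clinear_imp_bounded_linear[OF f] bounded_linear_ident])
  have bg: "bounded_linear ?g"
    by (rule bounded_linear_sum_on_product[OF bounded_linear_sum_on_product[OF
          bounded_clinear_imp_bounded_linear[OF g] bounded_linear_ident] bounded_linear_ident])
  have imf: "?f ` (A \<times> B) = f ` A + B"
    using image_sum_on_product[of f "\<lambda>x. x" A B] by simp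
  have img: "?g ` ((C \<times> D) \<times> G) = (g ` C + D) + G"
    using image_sum_on_product[of "\<lambda>p. g (fst p) + snd p" "\<lambda>x. x" "C \<times> D" G]
      image_sum_on_product[of g "\<lambda>x. x" C D] by simp
  have G': "csubspace G" "closed G"
    using G by (auto intro: cfinite_dim_imp_csubspace cfinite_dim_closed)
  have M: "csubspace (f ` A + B)" by (intro csubspace_plus csubspace_image f A B)
  have N: "csubspace (g ` C + D)" by (intro csubspace_plus csubspace_image g C D)
  have "topologically_complemented (?f ` (A \<times> B))"
  proof (rule topologically_complemented_if_Fredholm_pair[OF bf _ _ bg])
    show "subspace (A \<times> B)" "subspace ((C \<times> D) \<times> G)"
      by (intro subspace_Times csubspace_imp_subspace A B C D G')+
    show "closed (A \<times> B)" "closed ((C \<times> D) \<times> G)"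
      by (intro closed_Times A B C D G')+
    show "csubspace (?f ` (A \<times> B))" unfolding imf by (rule M)
    show "csubspace (?g ` ((C \<times> D) \<times> G))" unfolding img by (intro csubspace_plus N G')
    show "cfinite_dim (?f ` (A \<times> B) \<inter> ?g ` ((C \<times> D) \<times> G))"
      unfolding imf img by (rule cfinite_dim_Int_plus[OF M N fin G])
    show "?f ` (A \<times> B) + ?g ` ((C \<times> D) \<times> G) = UNIV"
      unfolding imf img using UN by (simp add: add.assoc)
  qed
  then show ?thesis unfolding imf .
qed

section \<open>Kernels and ranges of powers\<close>

lemma cfinite_dim_zero: "cfinite_dim {0}"
  using cfinite_dim_cspan[of "{}"] by simp

lemma range_funpow_antimono:
  fixes T :: "'a \<Rightarrow> 'a"
  assumes "n \<le> m"
  shows "range (T ^^ m) \<subseteq> range (T ^^ n)"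
proof -
  have "T ^^ m = T ^^ n \<circ> T ^^ (m - n)" using assms by (simp flip: funpow_add)
  then show ?thesis by auto
qed

text \<open>
  Induction on \<open>k\<close>: \<open>T\<close> maps the space for \<open>k + 1\<close> into the one for \<open>k\<close>, and the kernel of this map is
  contained in the given finite-dimensional space.
\<close>

lemma cfinite_dim_null_space_funpow_Int_range:
  fixes T :: "'a::complex_normed_vector \<Rightarrow> 'a"
  assumes T: "bounded_clinear T" and fin: "cfinite_dim (null_space T \<inter> range (T ^^ n))"
  shows "cfinite_dim (null_space (T ^^ k) \<inter> range (T ^^ n))"
proof (induction k)
  case 0
  interpret L: bounded_linear "T ^^ n"
    by (intro bounded_clinear_imp_bounded_linear bounded_clinear_funpow T)
  have "null_space (T ^^ 0) \<inter> range (T ^^ n) = {0}"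
    using rangeI[of "T ^^ n" 0] by (auto simp: null_space_def L.zero)
  then show ?case by (simp only: cfinite_dim_zero)
next
  case (Suc k)
  let ?U = "null_space (T ^^ Suc k) \<inter> range (T ^^ n)"
  have cs: "csubspace (null_space (T ^^ j))" "csubspace (range (T ^^ j))" for j
    by (intro csubspace_null_space csubspace_range
        bounded_clinear_funpow T)+
  have U: "csubspace ?U" by (intro complex_vector.subspace_inter cs)
  have "T ` ?U \<subseteq> null_space (T ^^ k) \<inter> range (T ^^ n)"
    by (auto simp: null_space_def funpow_swap1)
  then have "cfinite_dim (T ` ?U)"
    using Suc by (rule cfinite_dim_subset[OF csubspace_image[OF T U]])
  then obtain G where G: "cfinite_dim G" "?U \<subseteq> null_space T + G"
    by (rule cfinite_dim_image_decomposition[OF T])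
  have "?U \<inter> null_space T \<subseteq> null_space T \<inter> range (T ^^ n)" by blast
  then have "cfinite_dim (?U \<inter> null_space T)"
    using fin by (rule cfinite_dim_subset[rotated]) (intro complex_vector.subspace_inter U csubspace_null_space T)
  then have "cfinite_dim (?U \<inter> (null_space T + G))"
    by (intro cfinite_dim_Int_plus U csubspace_null_space T G)
  moreover have "?U \<inter> (null_space T + G) = ?U" using G by blast
  ultimately show ?case by (simp only:)
qed

text \<open>
  The map \<open>T ^^ n\<close> sends the kernel of \<open>T ^^ m\<close> into the intersection of that kernel with the range of
  \<open>T ^^ n\<close>, which is finite-dimensional. For \<open>m \<le> n\<close> the statement is trivial;
  treating both cases alike avoids comparing indices.
\<close>

lemma null_space_funpow_almost_increasing:
  fixes T :: "'a::complex_normed_vector \<Rightarrow> 'a"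
  assumes T: "bounded_clinear T" and fin: "cfinite_dim (null_space T \<inter> range (T ^^ n))"
  obtains G where "cfinite_dim G" "null_space (T ^^ m) \<subseteq> null_space (T ^^ n) + G"
proof -
  interpret L: bounded_linear "T ^^ k" for k
    by (intro bounded_clinear_imp_bounded_linear bounded_clinear_funpow T)
  have Tn: "bounded_clinear (T ^^ n)" by (rule bounded_clinear_funpow[OF T])
  have "(T ^^ m) ((T ^^ n) x) = (T ^^ n) ((T ^^ m) x)" for x
    using fun_cong[OF funpow_add[of m n T], of x] fun_cong[OF funpow_add[of n m T], of x] by (simp add: add.commute)
  then have "(T ^^ n) ` null_space (T ^^ m) \<subseteq> null_space (T ^^ m) \<inter> range (T ^^ n)"
    by (auto simp: null_space_def L.zero)
  then have "cfinite_dim ((T ^^ n) ` null_space (T ^^ m))"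
    using cfinite_dim_null_space_funpow_Int_range[OF T fin]
    by (rule cfinite_dim_subset[OF csubspace_image[OF Tn csubspace_null_space[OF bounded_clinear_funpow[OF T]]]])
  then show ?thesis using that cfinite_dim_image_decomposition[OF Tn] by blast
qed

lemma closed_complement:
  assumes "topologically_complemented M"
  obtains Z where "csubspace Z" "closed Z" "M \<inter> Z = {0}" "M + Z = UNIV"
  using assms unfolding topologically_complemented_def sums_eq_set_plus by blast

lemma in_plusE:
  assumes "x \<in> A + B"
  obtains a b where "a \<in> A" "b \<in> B" "x = a + b"
  using assms by (auto simp: set_plus_def)

text \<open>
  In terms of the operator \<open>S\<close> that \<open>T\<close> induces on the quotient by the kernel of \<open>T ^^ d\<close>: the range of
  \<open>S ^^ k\<close> is complemented for all \<open>k\<close> if the range of \<open>S\<close> is and the kernel of \<open>S\<close> is finite-dimensional.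
  If \<open>Z\<close> and \<open>Z1\<close> are complements for \<open>k\<close> and for \<open>1\<close>, then \<open>T ` Z + Z1\<close> is one for \<open>k + 1\<close>, up to a
  finite-dimensional intersection caused by the kernel of \<open>S\<close>.
\<close>

lemma topologically_complemented_range_funpow_plus_null_space:
  fixes T :: "'a::complex_banach \<Rightarrow> 'a"
  assumes T: "bounded_clinear T" and fin: "cfinite_dim (null_space T \<inter> range (T ^^ d))"
    and D: "topologically_complemented (range T + null_space (T ^^ d))"
  shows "topologically_complemented (range (T ^^ k) + null_space (T ^^ d))"
proof (induction k)
  case 0
  have "csubspace (null_space (T ^^ d))" by (intro csubspace_null_space bounded_clinear_funpow T)
  then have "range (T ^^ 0) + null_space (T ^^ d) = UNIV"
    using subset_plus_left by fastforce
  moreover have "topologically_complemented (UNIV :: 'a set)"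
    unfolding topologically_complemented_def sums_eq_set_plus
    by (intro conjI exI[of _ "{0}"])
      (auto simp: complex_vector.subspace_UNIV complex_vector.subspace_single_0 set_plus_def)
  ultimately show ?case by simp
next
  case (Suc k)
  interpret T: bounded_linear T by (rule bounded_clinear_imp_bounded_linear[OF T])
  let ?N = "null_space (T ^^ d)"
  let ?V = "\<lambda>k. range (T ^^ k) + ?N"
  have powc: "bounded_clinear (T ^^ j)" for j by (rule bounded_clinear_funpow[OF T])
  have N: "csubspace ?N" "closed ?N" by (intro csubspace_null_space closed_null_space powc)+
  have V: "csubspace (?V j)" for j by (intro csubspace_plus N csubspace_range powc)
  have V1: "csubspace (range T + ?N)" by (intro csubspace_plus N csubspace_range T)
  have TN: "T u \<in> ?N" if "u \<in> ?N" for u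
    using that by (simp add: null_space_def T.zero flip: funpow_swap1)
  obtain Z where Z: "csubspace Z" "closed Z" "?V k \<inter> Z = {0}" "?V k + Z = UNIV"
    using closed_complement[OF Suc.IH] by blast
  obtain Z1 where Z1: "csubspace Z1" "closed Z1" "(range T + ?N) \<inter> Z1 = {0}" "(range T + ?N) + Z1 = UNIV"
    using closed_complement[OF D] by blast
  obtain G where G: "cfinite_dim G" "null_space (T ^^ Suc d) \<subseteq> ?N + G"
    using null_space_funpow_almost_increasing[OF T fin] by blast
  show ?case
  proof (rule topologically_complemented_if_finite_overlap[OF powc _ _ N T Z(1,2) Z1(1,2) cfinite_dim_zero])
    \<comment> \<open>The component in \<open>Z1\<close> vanishes, and what remains is \<open>T z\<close> where \<open>z\<close> lies in \<open>?V k\<close> up to a vector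
      killed by \<open>T ^^ Suc d\<close>, that is, up to \<open>G\<close>.\<close>
    have "(?V (Suc k)) \<inter> (T ` Z + Z1) \<subseteq> T ` (Z \<inter> (?V k + G))"
    proof
      fix x assume x: "x \<in> ?V (Suc k) \<inter> (T ` Z + Z1)"
      from x have "x \<in> ?V (Suc k)" by blast
      then obtain w u where w: "u \<in> ?N" "x = T ((T ^^ k) w) + u"
        by (elim in_plusE) auto
      from x have "x \<in> T ` Z + Z1" by blast
      then obtain z z1 where z: "z \<in> Z" "z1 \<in> Z1" "x = T z + z1" by (elim in_plusE) auto
      have "z1 = T ((T ^^ k) w - z) + u" using w z by (simp add: T.diff algebra_simps)
      then have "z1 \<in> range T + ?N" using w by (auto intro: set_plus_intro)
      then have "z1 \<in> {0}" unfolding Z1(3)[symmetric] using z by blast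
      then have xz: "x = T z" using z by simp
      have "T (z - (T ^^ k) w) = u" using w xz by (simp add: T.diff)
      then have "z - (T ^^ k) w \<in> null_space (T ^^ Suc d)"
        using w(1) by (simp add: null_space_def funpow_swap1)
      then have "z - (T ^^ k) w \<in> ?N + G" using G by blast
      then have "(T ^^ k) w + (z - (T ^^ k) w) \<in> range (T ^^ k) + (?N + G)"
        by (intro set_plus_intro) auto
      then have "z \<in> ?V k + G" by (simp add: add.assoc)
      then show "x \<in> T ` (Z \<inter> (?V k + G))" using z xz by blast
    qed
    moreover have "cfinite_dim (T ` (Z \<inter> (?V k + G)))"
    proof (intro cfinite_dim_image T cfinite_dim_Int_plus[OF Z(1) V _ G(1)])
      show "cfinite_dim (Z \<inter> ?V k)" using Z(3) cfinite_dim_zero by (simp add: Int_commute)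
    qed
    ultimately show "cfinite_dim (?V (Suc k) \<inter> (T ` Z + Z1))"
      by (rule cfinite_dim_subset[rotated])
        (intro complex_vector.subspace_inter V csubspace_plus csubspace_image T Z Z1)
    have "x \<in> ?V (Suc k) + (T ` Z + Z1) + {0}" for x
    proof -
      have "x \<in> (range T + ?N) + Z1" using Z1 by simp
      then obtain y u z1 where x: "u \<in> ?N" "z1 \<in> Z1" "x = T y + u + z1" by (elim in_plusE) auto
      have "y \<in> ?V k + Z" using Z by simp
      then obtain w u' z where y: "u' \<in> ?N" "z \<in> Z" "y = (T ^^ k) w + u' + z" by (elim in_plusE) auto
      have "x = (((T ^^ Suc k) w + (T u' + u)) + (T z + z1)) + 0"
        using x(3) y(3) by (simp add: T.add)
      also have "\<dots> \<in> ?V (Suc k) + (T ` Z + Z1) + {0}"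
        by (intro set_plus_intro rangeI imageI singletonI x(2) y(2)
            complex_vector.subspace_add[OF N(1) TN[OF y(1)] x(1)])
      finally show ?thesis .
    qed
    then show "?V (Suc k) + (T ` Z + Z1) + {0} = UNIV" by blast
  qed (auto simp: complex_vector.subspace_UNIV)
qed

text \<open>
  Let \<open>Z\<close> be a complement of the sum of the range of \<open>T ^^ n\<close> and the kernel of \<open>T ^^ d\<close>. These two
  spaces intersect in a finite-dimensional space, so each of them, together with \<open>Z\<close>, is almost a
  complement of the other. The kernels of \<open>T ^^ d\<close> and \<open>T ^^ n\<close> differ by finite dimensions only, so the first can
  be replaced by the second.
\<close>

lemma topologically_complemented_range_and_null_space_funpow:
  fixes T :: "'a::complex_banach \<Rightarrow> 'a"
  assumes T: "bounded_clinear T" and fin_d: "cfinite_dim (null_space T \<inter> range (T ^^ d))"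
    and fin_n: "cfinite_dim (null_space T \<inter> range (T ^^ n))"
    and V: "topologically_complemented (range (T ^^ n) + null_space (T ^^ d))"
  shows "topologically_complemented (range (T ^^ n))"
    and "topologically_complemented (null_space (T ^^ n))"
proof -
  let ?R = "range (T ^^ n)" and ?Nd = "null_space (T ^^ d)" and ?Nn = "null_space (T ^^ n)"
  obtain Z where Z: "csubspace Z" "closed Z" "(?R + ?Nd) \<inter> Z = {0}" "(?R + ?Nd) + Z = UNIV"
    using closed_complement[OF V] by blast
  have powc: "bounded_clinear (T ^^ j)" for j by (rule bounded_clinear_funpow[OF T])
  have idc: "bounded_clinear (\<lambda>x::'a. x)" by (simp add: bounded_clinear_def bounded_linear_ident)
  have N: "csubspace (null_space (T ^^ j))" "closed (null_space (T ^^ j))" for j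
    by (intro csubspace_null_space closed_null_space powc)+
  have R: "csubspace ?R" by (rule csubspace_range[OF powc])
  have zero: "csubspace {0::'a}" "closed {0::'a}" by (auto simp: complex_vector.subspace_single_0)
  have U: "csubspace (UNIV :: 'a set)" "closed (UNIV :: 'a set)" by (auto simp: complex_vector.subspace_UNIV)
  have plus0: "A + {0} = A" for A :: "'a set" by (auto simp: set_plus_def)
  have disj: "v = 0" "z = 0" if "v = z" "v \<in> ?R + ?Nd" "z \<in> Z" for v z
    using that Z(3) by auto
  have fin: "cfinite_dim (?Nd \<inter> ?R)"
    by (rule cfinite_dim_null_space_funpow_Int_range[OF T fin_n])
  have "?R \<inter> (?Nd + Z) \<subseteq> ?Nd \<inter> ?R"
  proof
    fix x assume "x \<in> ?R \<inter> (?Nd + Z)"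
    then obtain u z where x: "x \<in> ?R" "u \<in> ?Nd" "z \<in> Z" "x = u + z" by (elim IntE in_plusE)
    have "x + (- u) \<in> ?R + ?Nd" by (intro set_plus_intro x complex_vector.subspace_neg N)
    then have "z = 0" using disj(2)[of "x - u" z] x by simp
    then show "x \<in> ?Nd \<inter> ?R" using x by simp
  qed
  then have fin1: "cfinite_dim (?R \<inter> (?Nd + Z))"
    using fin by (rule cfinite_dim_subset[rotated]) (intro complex_vector.subspace_inter csubspace_plus R N Z)
  have "topologically_complemented ((T ^^ n) ` UNIV + {0})"
  proof (rule topologically_complemented_if_finite_overlap[OF powc U zero idc N[of d] Z(1,2) cfinite_dim_zero])
    show "cfinite_dim ((?R + {0}) \<inter> ((\<lambda>x. x) ` ?Nd + Z))" using fin1 by (simp add: plus0)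
    show "?R + {0} + ((\<lambda>x. x) ` ?Nd + Z) + {0} = UNIV" using Z(4) by (simp add: plus0 add.assoc)
  qed
  then show "topologically_complemented ?R" by (simp add: plus0)
  have "?Nd \<inter> (?R + Z) \<subseteq> ?Nd \<inter> ?R"
  proof
    fix x assume "x \<in> ?Nd \<inter> (?R + Z)"
    then obtain u z where x: "x \<in> ?Nd" "u \<in> ?R" "z \<in> Z" "x = u + z" by (elim IntE in_plusE)
    have "- u + x \<in> ?R + ?Nd" by (intro set_plus_intro x complex_vector.subspace_neg R)
    then have "z = 0" using disj(2)[of "- u + x" z] x by simp
    then show "x \<in> ?Nd \<inter> ?R" using x by simp
  qed
  then have fin2: "cfinite_dim (?Nd \<inter> (?R + Z))"
    using fin by (rule cfinite_dim_subset[rotated]) (intro complex_vector.subspace_inter csubspace_plus R N Z)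
  obtain G where G: "cfinite_dim G" "?Nd \<subseteq> ?Nn + G"
    using null_space_funpow_almost_increasing[OF T fin_n] by blast
  obtain G' where G': "cfinite_dim G'" "?Nn \<subseteq> ?Nd + G'"
    using null_space_funpow_almost_increasing[OF T fin_d] by blast
  have "?Nn \<inter> (?R + Z) \<subseteq> (?R + Z) \<inter> (?Nd + G')" using G' by blast
  moreover have "cfinite_dim ((?R + Z) \<inter> (?Nd + G'))"
  proof (rule cfinite_dim_Int_plus[OF _ N(1) _ G'(1)])
    show "csubspace (?R + Z)" by (intro csubspace_plus R Z)
    show "cfinite_dim ((?R + Z) \<inter> ?Nd)" using fin2 by (simp add: Int_commute)
  qed
  ultimately have fin3: "cfinite_dim (?Nn \<inter> (?R + Z))"
    by (rule cfinite_dim_subset[rotated]) (intro complex_vector.subspace_inter csubspace_plus R N Z)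
  have "topologically_complemented ((\<lambda>x. x) ` ?Nn + {0})"
  proof (rule topologically_complemented_if_finite_overlap[OF idc N[of n] zero powc U Z(1,2) G(1)])
    show "cfinite_dim (((\<lambda>x. x) ` ?Nn + {0}) \<inter> (?R + Z))" using fin3 by (simp add: plus0)
    have "UNIV = (?R + Z) + ?Nd" using Z(4) by (simp add: ac_simps)
    also have "\<dots> \<subseteq> (?R + Z) + (?Nn + G)" by (intro set_plus_mono2 G order_refl)
    finally show "(\<lambda>x. x) ` ?Nn + {0} + (?R + Z) + G = UNIV" by (simp add: plus0 ac_simps top.extremum_unique)
  qed
  then show "topologically_complemented ?Nn" by (simp add: plus0)
qed

text \<open>
  The sum is the preimage of the range of \<open>T ^^ Suc d\<close> under \<open>T ^^ d\<close>, hence closed. Since \<open>T ^^ d\<close> is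
  injective on a complement \<open>E\<close> of its kernel, the complement \<open>C\<close> of that range can be pulled back to \<open>E\<close>.
\<close>

lemma topologically_complemented_range_plus_null_space:
  fixes T :: "'a::complex_banach \<Rightarrow> 'a"
  assumes T: "bounded_clinear T"
    and N: "topologically_complemented (null_space (T ^^ d))"
    and R: "topologically_complemented (range (T ^^ Suc d))"
  shows "topologically_complemented (range T + null_space (T ^^ d))"
proof -
  let ?N = "null_space (T ^^ d)" and ?R = "range (T ^^ Suc d)"
  have powc: "bounded_clinear (T ^^ j)" for j by (rule bounded_clinear_funpow[OF T])
  interpret L: bounded_linear "T ^^ d" by (rule bounded_clinear_imp_bounded_linear[OF powc])
  obtain E where E: "csubspace E" "closed E" "?N \<inter> E = {0}" "?N + E = UNIV"
    using closed_complement[OF N] by blast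
  obtain C where C: "csubspace C" "closed C" "?R \<inter> C = {0}" "?R + C = UNIV"
    using closed_complement[OF R] by blast
  have R': "closed ?R" using R by (simp add: topologically_complemented_def)
  have Nsub: "csubspace ?N" by (intro csubspace_null_space powc)
  have swap: "(T ^^ d) (T y) = (T ^^ Suc d) y" for y by (simp add: funpow_swap1)
  let ?W = "range T + ?N" and ?K = "E \<inter> (T ^^ d) -` C"
  have W: "csubspace ?W" by (intro csubspace_plus Nsub csubspace_range T)
  have W_eq: "?W = (T ^^ d) -` ?R"
  proof
    show "?W \<subseteq> (T ^^ d) -` ?R"
      by (auto elim!: in_plusE simp: null_space_def L.add swap simp del: funpow.simps)
    show "(T ^^ d) -` ?R \<subseteq> ?W"
    proof
      fix x assume "x \<in> (T ^^ d) -` ?R"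
      then obtain y where "(T ^^ d) x = (T ^^ d) (T y)" by (auto simp: swap simp del: funpow.simps)
      then have "x - T y \<in> ?N" by (simp add: null_space_def L.diff)
      then have "T y + (x - T y) \<in> ?W" by (intro set_plus_intro) auto
      then show "x \<in> ?W" by simp
    qed
  qed
  have K: "csubspace ?K" "closed ?K"
    by (intro complex_vector.subspace_inter E csubspace_vimage powc C)
      (intro closed_Int E closed_vimage_bounded_clinear powc C)
  have clW: "closed ?W" unfolding W_eq by (rule closed_vimage_bounded_clinear[OF powc R'])
  have "x = 0" if x: "x \<in> ?W \<inter> ?K" for x
  proof -
    have "(T ^^ d) x \<in> ?R \<inter> C" using x unfolding W_eq by blast
    then have "(T ^^ d) x = 0" unfolding C(3) by simp
    then have "x \<in> ?N \<inter> E" using x by (simp add: null_space_def)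
    then show ?thesis using E(3) by simp
  qed
  moreover have "0 \<in> ?W \<inter> ?K" using W K complex_vector.subspace_0 by blast
  ultimately have WK: "?W \<inter> ?K = {0}" by blast
  have "x \<in> ?W + ?K" for x
  proof -
    have "(T ^^ d) x \<in> ?R + C" using C by simp
    then obtain y c where x: "c \<in> C" "(T ^^ d) x = (T ^^ d) (T y) + c"
      by (elim in_plusE) (auto simp: swap simp del: funpow.simps)
    have "x - T y \<in> ?N + E" using E by simp
    then obtain u e where e: "u \<in> ?N" "e \<in> E" "x - T y = u + e" by (elim in_plusE)
    have "(T ^^ d) (u + e) = c" using x by (simp add: L.diff flip: e(3))
    then have "(T ^^ d) e = c" using e(1) by (simp add: L.add null_space_def)
    then have "(T y + u) + e \<in> ?W + ?K" using x e by (intro set_plus_intro) auto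
    moreover have "x = (T y + u) + e" using e(3) by (simp add: algebra_simps)
    ultimately show ?thesis by simp
  qed
  then have "?W + ?K = UNIV" by blast
  then show ?thesis
    unfolding topologically_complemented_def sums_eq_set_plus using W clW K WK by blast
qed

text \<open>
  Choose a member with a finite spanning set of least cardinality, among all members: a strictly smaller
  later member would have a basis with fewer elements.
\<close>

lemma decreasing_cfinite_dim_stabilizes:
  fixes U :: "nat \<Rightarrow> 'a::complex_vector set"
  assumes sub: "\<And>n. csubspace (U n)" and anti: "\<And>n m. n \<le> m \<Longrightarrow> U m \<subseteq> U n" and fin: "cfinite_dim (U n0)"
  shows "\<exists>n. \<forall>m\<ge>n. U m = U n"
proof -
  define Q where "Q c \<longleftrightarrow> (\<exists>n B. finite B \<and> cspan B = U n \<and> card B = c)" for c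
  have "\<exists>c. Q c" using fin by (auto simp: Q_def cfinite_dim_def)
  then have "Q (LEAST c. Q c)" by (rule LeastI_ex)
  then obtain n B where B: "finite B" "cspan B = U n" and card: "card B = (LEAST c. Q c)"
    unfolding Q_def by blast
  have min: "card B \<le> card C" if "finite C" "cspan C = U m" for C m
    unfolding card by (rule Least_le) (use that in \<open>auto simp: Q_def\<close>)
  have "U n \<subseteq> U m" if nm: "n \<le> m" for m
  proof (rule ccontr)
    assume "\<not> U n \<subseteq> U m"
    then obtain x where x: "x \<in> U n" "x \<notin> U m" by blast
    obtain C where C: "C \<subseteq> U m" "complex_vector.independent C" "U m \<subseteq> cspan C"
      using complex_vector.maximal_independent_subset by blast
    have span: "cspan C = U m" using C complex_vector.span_minimal[OF C(1) sub] by blast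
    have ind: "complex_vector.independent (insert x C)"
      by (rule complex_vector.independent_insertI) (use C x span in auto)
    have "insert x C \<subseteq> cspan B" using B(2) x C(1) anti[OF nm] by blast
    then have *: "finite (insert x C)" "card (insert x C) \<le> card B"
      using complex_vector.independent_span_bound[OF B(1) ind] by auto
    moreover have "x \<notin> C" using C(1) x by blast
    ultimately have "card C < card B" by simp
    then show False using min[OF _ span] * by simp
  qed
  then show ?thesis using anti by (intro exI[of _ n] allI impI equalityI)
qed

lemma Inf_enat_mem:
  fixes A :: "enat set"
  assumes "A \<noteq> {}"
  shows "Inf A \<in> A"
proof -
  have "\<exists>x. x \<in> A" using assms by blast
  then have "(LEAST x. x \<in> A) \<in> A" by (rule LeastI_ex)
  then show ?thesis using assms by (simp add: Inf_enat_def)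
qed

lemma cfinite_dim_of_essential_ascent_le:
  fixes T :: "'a::complex_normed_vector \<Rightarrow> 'a"
  assumes T: "bounded_clinear T" and le: "essential_ascent T \<le> enat n"
  shows "cfinite_dim (null_space T \<inter> range (T ^^ n))"
proof -
  define A where "A = {enat n | n. cfinite_dim (null_space T \<inter> range (T ^^ n))}"
  have a: "essential_ascent T = Inf A" by (simp add: essential_ascent_def A_def)
  have "A \<noteq> {}"
  proof
    assume "A = {}"
    then have "essential_ascent T = \<infinity>" unfolding a by (simp add: Inf_enat_def)
    then show False using le by simp
  qed
  then have Inf: "Inf A \<in> A" by (rule Inf_enat_mem)
  then obtain n0 where n0: "Inf A = enat n0" "cfinite_dim (null_space T \<inter> range (T ^^ n0))"
    unfolding A_def by blast
  then have "n0 \<le> n" using le a by simp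
  then have "null_space T \<inter> range (T ^^ n) \<subseteq> null_space T \<inter> range (T ^^ n0)"
    using range_funpow_antimono[of n0 n T] by blast
  then show ?thesis using n0(2)
    by (rule cfinite_dim_subset[rotated])
      (intro complex_vector.subspace_inter csubspace_null_space csubspace_range
        bounded_clinear_funpow T)
qed

text \<open>
  The degree of stable iteration has to be shown finite here, since \<open>the_enat\<close> is unspecified at \<open>\<infinity>\<close>:
  the intersections of the kernel with the ranges of the powers decrease and become finite-dimensional.
\<close>

lemma essential_ascent_le_stable_iteration_degree:
  fixes T :: "'a::complex_normed_vector \<Rightarrow> 'a"
  assumes T: "bounded_clinear T" and fin: "essential_ascent T < \<infinity>"
  shows "essential_ascent T \<le> enat (the_enat (stable_iteration_degree T))"
proof -
  define U where "U n = null_space T \<inter> range (T ^^ n)" for n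
  define A where "A = {enat n | n. \<forall>m\<ge>n. m \<ge> 1 \<longrightarrow> U n = U m}"
  have dis: "stable_iteration_degree T = Inf A" by (simp add: stable_iteration_degree_def A_def U_def)
  obtain n0 where n0: "essential_ascent T = enat n0" using fin by auto
  then have fin0: "cfinite_dim (U n0)"
    unfolding U_def by (intro cfinite_dim_of_essential_ascent_le[OF T]) simp
  have sub: "csubspace (U n)" for n
    unfolding U_def by (intro complex_vector.subspace_inter csubspace_null_space csubspace_range
        bounded_clinear_funpow T)
  have anti: "U m \<subseteq> U n" if "n \<le> m" for n m
    using range_funpow_antimono[OF that, of T] unfolding U_def by blast
  have "\<exists>n. \<forall>m\<ge>n. U m = U n"
    using sub anti fin0 by (rule decreasing_cfinite_dim_stabilizes)
  then obtain n where n: "\<forall>m\<ge>n. U m = U n" ..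
  have "U n = U m" if "n \<le> m" for m by (rule n[rule_format, OF that, symmetric])
  then have "enat n \<in> A" unfolding A_def by blast
  then have "A \<noteq> {}" by blast
  then have Inf: "Inf A \<in> A" by (rule Inf_enat_mem)
  then obtain d where d: "Inf A = enat d" "\<And>m. m \<ge> d \<Longrightarrow> m \<ge> 1 \<Longrightarrow> U d = U m"
    unfolding A_def by blast
  \<comment> \<open>The successor of \<open>n0\<close> is needed since the defining condition is only about positive exponents.\<close>
  have "U d = U (max d (Suc n0))" by (rule d(2)) auto
  also have "\<dots> \<subseteq> U n0" by (rule anti) auto
  finally have "cfinite_dim (U d)" using fin0 by (rule cfinite_dim_subset[OF sub])
  then have "essential_ascent T \<le> enat d"
    unfolding essential_ascent_def U_def by (intro Inf_lower) blast
  then show ?thesis by (simp add: dis d(1))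
qed

theorem theorem3p5:
  fixes T :: "'a::complex_banach \<Rightarrow> 'a"
  assumes "\<not> cfinite_dim (UNIV :: 'a set)"
    and "bounded_clinear T"
  shows "essentially_left_Drazin_invertible T \<longleftrightarrow>
    essential_ascent T < \<infinity> \<and>
    (\<forall>n::nat. enat n \<ge> essential_ascent T \<longrightarrow>
       topologically_complemented (null_space (T ^^ n)) \<and>
       topologically_complemented (range (T ^^ n)))"
proof (cases "essential_ascent T < \<infinity>")
  case True
  note T = assms(2)
  define d where "d = the_enat (stable_iteration_degree T)"
  have d: "essential_ascent T \<le> enat d"
    unfolding d_def by (rule essential_ascent_le_stable_iteration_degree[OF T True])
  have "topologically_complemented (range T + null_space (T ^^ d)) \<longleftrightarrow>
    (\<forall>n::nat. enat n \<ge> essential_ascent T \<longrightarrow>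
       topologically_complemented (null_space (T ^^ n)) \<and>
       topologically_complemented (range (T ^^ n)))" (is "?D \<longleftrightarrow> ?C")
  proof
    assume D: ?D
    show ?C
    proof (intro allI impI)
      fix n assume "enat n \<ge> essential_ascent T"
      note fin = cfinite_dim_of_essential_ascent_le[OF T]
      have "topologically_complemented (range (T ^^ n) + null_space (T ^^ d))"
        by (rule topologically_complemented_range_funpow_plus_null_space[OF T fin[OF d] D])
      then show "topologically_complemented (null_space (T ^^ n)) \<and> topologically_complemented (range (T ^^ n))"
        using topologically_complemented_range_and_null_space_funpow[OF T fin[OF d] fin[OF \<open>enat n \<ge> _\<close>]]
        by blast
    qed
  next
    assume C: ?C
    have "essential_ascent T \<le> enat (Suc d)" using d by (rule order_trans) simp
    then show ?D using C d by (intro topologically_complemented_range_plus_null_space[OF T]) blast+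
  qed
  then show ?thesis
    using True by (simp add: essentially_left_Drazin_invertible_def sums_eq_set_plus d_def)
next
  case False
  then show ?thesis by (simp add: essentially_left_Drazin_invertible_def)
qed

end
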